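(* Let $A$ be a left s-unital ring. Then ${}_A\mathrm{UMod} = {}_A\mathrm{FMod} = {}_A\mathrm{SMod}$; that is, for a left $A$-module the properties of being unitary, firm, and s-unital are equivalent.
   Context: Rings are associative but not necessarily unital. A left $A$-module is an additive group $M$ with a biadditive map $A\times M\to M$, $(a,m)\mapsto am$, satisfying $(aa')m=a(a'm)$; ${}_A\mathrm{Mod}$ is the category of left $A$-modules and $A$-linear maps. Let $AM$ be the set of finite sums of elements $am$ with $a\in A$, $m\in M$. $M$ is unitary if $AM=M$; firm if the map $A\otimes_A M\to M$, $a\otimes m\mapsto am$, is an isomorphism (where $A\otimes_A M$ is the quotient of $A\otimes_{\mathbb Z}M$ by the subgroup generated by all $aa'\otimes m-a\otimes a'm$); and s-unital if $m\in Am$ for every $m\in M$. ${}_A\mathrm{UMod}$, ${}_A\mathrm{FMod}$, ${}_A\mathrm{SMod}$ are the full subcategories of ${}_A\mathrm{Mod}$ of unitary, firm, s-unital modules, respectively. The ring $A$ is left s-unital if it is s-unital as a left $A$-module. *)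

theory Defs
  imports "HOL-Algebra.Module" "HOL-Algebra.Generated_Groups" "HOL-Algebra.Free_Abelian_Groups"
begin

text \<open>The locale \<^locale>\<open>ring\<close> requires a unit, so non-unital rings get their own locale. The
  record fields \<open>one\<close> of a ring and \<open>mult\<close>, \<open>one\<close> of a module are unconstrained and carry
  no meaning.\<close>

locale nonunital_ring = abelian_group R for R (structure) +
  assumes m_closed: "\<lbrakk>x \<in> carrier R; y \<in> carrier R\<rbrakk> \<Longrightarrow> x \<otimes> y \<in> carrier R"
    and m_assoc: "\<lbrakk>x \<in> carrier R; y \<in> carrier R; z \<in> carrier R\<rbrakk>
      \<Longrightarrow> (x \<otimes> y) \<otimes> z = x \<otimes> (y \<otimes> z)"
    and l_distr: "\<lbrakk>x \<in> carrier R; y \<in> carrier R; z \<in> carrier R\<rbrakk>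
      \<Longrightarrow> (x \<oplus> y) \<otimes> z = x \<otimes> z \<oplus> y \<otimes> z"
    and r_distr: "\<lbrakk>x \<in> carrier R; y \<in> carrier R; z \<in> carrier R\<rbrakk>
      \<Longrightarrow> z \<otimes> (x \<oplus> y) = z \<otimes> x \<oplus> z \<otimes> y"

locale left_module = A?: nonunital_ring A + M?: abelian_group M
  for A (structure) and M :: "('a, 'b, 'q) module_scheme" (structure) +
  assumes smult_closed: "\<lbrakk>a \<in> carrier A; m \<in> carrier M\<rbrakk> \<Longrightarrow> a \<odot>\<^bsub>M\<^esub> m \<in> carrier M"
    and smult_l_distr: "\<lbrakk>a \<in> carrier A; b \<in> carrier A; m \<in> carrier M\<rbrakk>
      \<Longrightarrow> (a \<oplus> b) \<odot>\<^bsub>M\<^esub> m = a \<odot>\<^bsub>M\<^esub> m \<oplus>\<^bsub>M\<^esub> b \<odot>\<^bsub>M\<^esub> m"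
    and smult_r_distr: "\<lbrakk>a \<in> carrier A; m \<in> carrier M; n \<in> carrier M\<rbrakk>
      \<Longrightarrow> a \<odot>\<^bsub>M\<^esub> (m \<oplus>\<^bsub>M\<^esub> n) = a \<odot>\<^bsub>M\<^esub> m \<oplus>\<^bsub>M\<^esub> a \<odot>\<^bsub>M\<^esub> n"
    and smult_assoc: "\<lbrakk>a \<in> carrier A; b \<in> carrier A; m \<in> carrier M\<rbrakk>
      \<Longrightarrow> (a \<otimes> b) \<odot>\<^bsub>M\<^esub> m = a \<odot>\<^bsub>M\<^esub> (b \<odot>\<^bsub>M\<^esub> m)"

definition regular_module :: "('a, 'p) ring_scheme \<Rightarrow> ('a, 'a) module" where
  "regular_module A = \<lparr>carrier = carrier A, mult = mult A, one = one A,
     ring.zero = \<zero>\<^bsub>A\<^esub>, add = add A, smult = mult A\<rparr>"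

lemma left_module_regular_module:
  assumes "nonunital_ring A"
  shows "left_module A (regular_module A)"
proof -
  interpret A: nonunital_ring A by fact
  have "abelian_group (regular_module A)"
    by (rule abelian_groupI)
      (auto simp: regular_module_def A.a_assoc A.a_comm A.a_lcomm intro: A.l_neg)
  then show ?thesis
    by (intro left_module.intro left_module_axioms.intro assms)
      (auto simp: regular_module_def A.m_closed A.m_assoc A.l_distr A.r_distr)
qed


text \<open>The tensor product over the integers of two abelian groups (written additively), as the
  free abelian group on pairs modulo the biadditivity relations.\<close>

definition biadditive_relations ::
  "('a, 'p) ring_scheme \<Rightarrow> ('b, 'q) ring_scheme \<Rightarrow> ('a \<times> 'b \<Rightarrow>\<^sub>0 int) set" where
  "biadditive_relations G H = generate (free_Abelian_group (carrier G \<times> carrier H))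
     ({frag_of (x \<oplus>\<^bsub>G\<^esub> x', y) - frag_of (x, y) - frag_of (x', y) | x x' y.
         x \<in> carrier G \<and> x' \<in> carrier G \<and> y \<in> carrier H} \<union>
      {frag_of (x, y \<oplus>\<^bsub>H\<^esub> y') - frag_of (x, y) - frag_of (x, y') | x y y'.
         x \<in> carrier G \<and> y \<in> carrier H \<and> y' \<in> carrier H})"

definition int_tensor ::
  "('a, 'p) ring_scheme \<Rightarrow> ('b, 'q) ring_scheme \<Rightarrow> ('a \<times> 'b \<Rightarrow>\<^sub>0 int) set monoid" where
  "int_tensor G H =
     free_Abelian_group (carrier G \<times> carrier H) Mod biadditive_relations G H"

definition int_pure_tensor ::
  "('a, 'p) ring_scheme \<Rightarrow> ('b, 'q) ring_scheme \<Rightarrow> 'a \<Rightarrow> 'b \<Rightarrow> ('a \<times> 'b \<Rightarrow>\<^sub>0 int) set" where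
  "int_pure_tensor G H x y =
     biadditive_relations G H #>\<^bsub>free_Abelian_group (carrier G \<times> carrier H)\<^esub> frag_of (x, y)"


text \<open>The tensor product over \<open>A\<close> of the right regular module \<open>A\<close> and a left module \<open>M\<close>. The
  group \<^const>\<open>int_tensor\<close> is written multiplicatively.\<close>

definition balanced_relations ::
  "('a, 'p) ring_scheme \<Rightarrow> ('a, 'b, 'q) module_scheme \<Rightarrow> ('a \<times> 'b \<Rightarrow>\<^sub>0 int) set set" where
  "balanced_relations A M = generate (int_tensor A M)
     {int_pure_tensor A M (a \<otimes>\<^bsub>A\<^esub> a') m \<otimes>\<^bsub>int_tensor A M\<^esub>
        inv\<^bsub>int_tensor A M\<^esub> (int_pure_tensor A M a (a' \<odot>\<^bsub>M\<^esub> m)) | a a' m.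
        a \<in> carrier A \<and> a' \<in> carrier A \<and> m \<in> carrier M}"

definition ring_tensor ::
  "('a, 'p) ring_scheme \<Rightarrow> ('a, 'b, 'q) module_scheme
     \<Rightarrow> ('a \<times> 'b \<Rightarrow>\<^sub>0 int) set set monoid" where
  "ring_tensor A M = int_tensor A M Mod balanced_relations A M"

definition pure_tensor ::
  "('a, 'p) ring_scheme \<Rightarrow> ('a, 'b, 'q) module_scheme \<Rightarrow> 'a \<Rightarrow> 'b
     \<Rightarrow> ('a \<times> 'b \<Rightarrow>\<^sub>0 int) set set" where
  "pure_tensor A M a m = balanced_relations A M #>\<^bsub>int_tensor A M\<^esub> int_pure_tensor A M a m"


text \<open>The additive map \<open>a \<otimes> m \<mapsto> am\<close>: first on formal integer combinations of pairs, then
  induced on the two successive quotients, where every coset has a one-element image. That it is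
  the intended homomorphism is shown in \<open>tensor_action_hom\<close> and \<open>tensor_action_pure_tensor\<close>.\<close>

definition free_action ::
  "('a, 'b, 'q) module_scheme \<Rightarrow> ('a \<times> 'b \<Rightarrow>\<^sub>0 int) \<Rightarrow> 'b" where
  "free_action M c = (\<Oplus>\<^bsub>M\<^esub>p\<in>Poly_Mapping.keys c.
     [Poly_Mapping.lookup c p] \<cdot>\<^bsub>M\<^esub> (fst p \<odot>\<^bsub>M\<^esub> snd p))"

definition int_tensor_action ::
  "('a, 'b, 'q) module_scheme \<Rightarrow> ('a \<times> 'b \<Rightarrow>\<^sub>0 int) set \<Rightarrow> 'b" where
  "int_tensor_action M X = the_elem (free_action M ` X)"

definition tensor_action ::
  "('a, 'b, 'q) module_scheme \<Rightarrow> ('a \<times> 'b \<Rightarrow>\<^sub>0 int) set set \<Rightarrow> 'b" where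
  "tensor_action M Y = the_elem (int_tensor_action M ` Y)"


definition smult_span ::
  "('a, 'p) ring_scheme \<Rightarrow> ('a, 'b, 'q) module_scheme \<Rightarrow> 'b set" where
  "smult_span A M = {\<Oplus>\<^bsub>M\<^esub>i\<in>{..<n}. a i \<odot>\<^bsub>M\<^esub> m i | (n::nat) a m.
     a \<in> {..<n} \<rightarrow> carrier A \<and> m \<in> {..<n} \<rightarrow> carrier M}"

definition unitary :: "('a, 'p) ring_scheme \<Rightarrow> ('a, 'b, 'q) module_scheme \<Rightarrow> bool" where
  "unitary A M \<longleftrightarrow> smult_span A M = carrier M"

definition firm :: "('a, 'p) ring_scheme \<Rightarrow> ('a, 'b, 'q) module_scheme \<Rightarrow> bool" where
  "firm A M \<longleftrightarrow> tensor_action M \<in> iso (ring_tensor A M) (add_monoid M)"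

definition s_unital :: "('a, 'p) ring_scheme \<Rightarrow> ('a, 'b, 'q) module_scheme \<Rightarrow> bool" where
  "s_unital A M \<longleftrightarrow> (\<forall>m\<in>carrier M. m \<in> {a \<odot>\<^bsub>M\<^esub> m | a. a \<in> carrier A})"

definition left_s_unital_ring :: "('a, 'p) ring_scheme \<Rightarrow> bool" where
  "left_s_unital_ring A \<longleftrightarrow> nonunital_ring A \<and> s_unital A (regular_module A)"

text \<open>A full subcategory of the category of left modules is determined by its objects, and is
  represented by them.\<close>

definition UMod :: "('a, 'p) ring_scheme \<Rightarrow> ('a, 'b, 'q) module_scheme set" where
  "UMod A = {M. left_module A M \<and> unitary A M}"

definition FMod :: "('a, 'p) ring_scheme \<Rightarrow> ('a, 'b, 'q) module_scheme set" where
  "FMod A = {M. left_module A M \<and> firm A M}"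

definition SMod :: "('a, 'p) ring_scheme \<Rightarrow> ('a, 'b, 'q) module_scheme set" where
  "SMod A = {M. left_module A M \<and> s_unital A M}"


lemma biadditive_relations_normal:
  assumes "abelian_group G" "abelian_group H"
  shows "biadditive_relations G H \<lhd> free_Abelian_group (carrier G \<times> carrier H)"
proof -
  interpret G: abelian_group G by fact
  interpret H: abelian_group H by fact
  let ?F = "free_Abelian_group (carrier G \<times> carrier H)"
  interpret F: comm_group ?F by (rule abelian_free_Abelian_group)
  have *: "frag_of (u, v) - frag_of (u', v') - frag_of (u'', v'') \<in> carrier ?F"
    if "u \<in> carrier G" "u' \<in> carrier G" "u'' \<in> carrier G"
      "v \<in> carrier H" "v' \<in> carrier H" "v'' \<in> carrier H" for u u' u'' v v' v''
    using that keys_diff[of "frag_of (u, v) - frag_of (u', v')" "frag_of (u'', v'')"]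
      keys_diff[of "frag_of (u, v)" "frag_of (u', v')"]
    by (auto simp: free_Abelian_group_def)
  show ?thesis
    unfolding biadditive_relations_def
    by (intro F.subgroup_imp_normal F.generate_is_subgroup) (auto intro!: *)
qed

lemma (in group_hom) induced_on_quotient:
  assumes "N \<lhd> G" "N \<subseteq> kernel G H h"
  shows induced_coset: "\<And>x. x \<in> carrier G \<Longrightarrow> the_elem (h ` (N #>\<^bsub>G\<^esub> x)) = h x"
    and induced_hom: "(\<lambda>X. the_elem (h ` X)) \<in> hom (G Mod N) H"
proof -
  interpret N: normal N G by fact
  have img: "h ` (N #>\<^bsub>G\<^esub> x) = {h x}" if x: "x \<in> carrier G" for x
  proof -
    have "h (n \<otimes>\<^bsub>G\<^esub> x) = h x" if "n \<in> N" for n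
    proof -
      have "n \<in> carrier G" "h n = \<one>\<^bsub>H\<^esub>"
        using that assms(2) by (auto simp: kernel_def)
      then show ?thesis using x by simp
    qed
    moreover have "x \<in> N #>\<^bsub>G\<^esub> x" using x by (rule G.rcos_self[OF _ N.subgroup_axioms])
    ultimately show ?thesis by (force simp: r_coset_def)
  qed
  show c: "the_elem (h ` (N #>\<^bsub>G\<^esub> x)) = h x" if "x \<in> carrier G" for x
    using img[OF that] by simp
  obtain g where g: "g \<in> hom (G Mod N) H" "\<And>x. x \<in> carrier G \<Longrightarrow> g (N #>\<^bsub>G\<^esub> x) = h x"
    using FactGroup_universal_kernel[OF assms] by blast
  have eq: "the_elem (h ` X) = g X" if "X \<in> carrier (G Mod N)" for X
    using that g(2) c by (auto simp: carrier_FactGroup)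
  interpret Q: group "G Mod N" by (rule N.factorgroup_is_group)
  show "(\<lambda>X. the_elem (h ` X)) \<in> hom (G Mod N) H"
  proof (rule homI)
    fix X Y assume X: "X \<in> carrier (G Mod N)" and Y: "Y \<in> carrier (G Mod N)"
    show "the_elem (h ` X) \<in> carrier H"
      using eq[OF X] hom_in_carrier[OF g(1) X] by simp
    show "the_elem (h ` (X \<otimes>\<^bsub>G Mod N\<^esub> Y)) = the_elem (h ` X) \<otimes>\<^bsub>H\<^esub> the_elem (h ` Y)"
      using eq[OF X] eq[OF Y] eq[OF Q.m_closed[OF X Y]] Group.hom_mult[OF g(1) X Y] by simp
  qed
qed

context left_module
begin

abbreviation (input) "FG \<equiv> free_Abelian_group (carrier A \<times> carrier M)"

lemma free_action_frag_of:
  assumes "a \<in> carrier A" "m \<in> carrier M"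
  shows "free_action M (frag_of (a, m)) = a \<odot>\<^bsub>M\<^esub> m"
  using assms by (simp add: free_action_def smult_closed M.finsum_insert)

lemma free_action_superset:
  assumes "finite S" "Poly_Mapping.keys c \<subseteq> S" "S \<subseteq> carrier A \<times> carrier M"
  shows "free_action M c =
    (\<Oplus>\<^bsub>M\<^esub>p\<in>S. [Poly_Mapping.lookup c p] \<cdot>\<^bsub>M\<^esub> (fst p \<odot>\<^bsub>M\<^esub> snd p))"
  unfolding free_action_def
  by (rule M.add.finprod_mono_neutral_cong_left)
    (use assms in \<open>auto simp: in_keys_iff add_pow_def int_pow_0 intro!: M.add.int_pow_closed[unfolded add_pow_def] smult_closed\<close>)

lemma free_action_hom: "free_action M \<in> hom FG (add_monoid M)"
proof (rule homI)
  show "free_action M c \<in> carrier (add_monoid M)" if "c \<in> carrier FG" for c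
    using that unfolding free_action_def
    by (auto simp: free_Abelian_group_def intro!: M.finsum_closed M.add.int_pow_closed smult_closed)
  show "free_action M (c \<otimes>\<^bsub>FG\<^esub> d) = free_action M c \<otimes>\<^bsub>add_monoid M\<^esub> free_action M d"
    if "c \<in> carrier FG" "d \<in> carrier FG" for c d
  proof -
    let ?S = "Poly_Mapping.keys c \<union> Poly_Mapping.keys d"
    have S: "finite ?S" "?S \<subseteq> carrier A \<times> carrier M"
      using that by (auto simp: free_Abelian_group_def)
    have "free_action M (c + d) = (\<Oplus>\<^bsub>M\<^esub>p\<in>?S.
        [Poly_Mapping.lookup c p] \<cdot>\<^bsub>M\<^esub> (fst p \<odot>\<^bsub>M\<^esub> snd p) \<oplus>\<^bsub>M\<^esub>
        [Poly_Mapping.lookup d p] \<cdot>\<^bsub>M\<^esub> (fst p \<odot>\<^bsub>M\<^esub> snd p))"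
      using S keys_add[of c d]
      by (subst free_action_superset[of ?S])
        (auto simp: lookup_add M.add.int_pow_mult smult_closed subset_iff
          intro!: M.add.finprod_cong')
    also have "\<dots> = free_action M c \<oplus>\<^bsub>M\<^esub> free_action M d"
      using S by (subst M.finsum_addf)
        (auto simp: free_action_superset[of ?S] intro!: M.add.int_pow_closed smult_closed)
    finally show ?thesis by (simp add: free_Abelian_group_def)
  qed
qed

lemma int_tensor_action_hom: "int_tensor_action M \<in> hom (int_tensor A M) (add_monoid M)"
  and int_tensor_action_pure: "\<lbrakk>a \<in> carrier A; m \<in> carrier M\<rbrakk>
    \<Longrightarrow> int_tensor_action M (int_pure_tensor A M a m) = a \<odot>\<^bsub>M\<^esub> m"
proof -
  interpret F: comm_group FG by (rule abelian_free_Abelian_group)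
  interpret h: group_hom FG "add_monoid M" "free_action M"
    by (intro group_hom.intro group_hom_axioms.intro free_action_hom M.a_group F.is_group)
  have f: "frag_of (a, m) \<in> carrier FG" if "a \<in> carrier A" "m \<in> carrier M" for a m
    using that by (simp add: free_Abelian_group_def)
  have d: "c - d \<in> carrier FG \<and> free_action M (c - d) = free_action M c \<ominus>\<^bsub>M\<^esub> free_action M d"
    if "c \<in> carrier FG" "d \<in> carrier FG" for c d
  proof -
    have eq: "c - d = c \<otimes>\<^bsub>FG\<^esub> inv\<^bsub>FG\<^esub> d"
      using that by (simp add: free_Abelian_group_def inv_free_Abelian_group
          flip: free_Abelian_group_def)
    show ?thesis
      unfolding eq h.hom_mult[OF that(1) F.inv_closed[OF that(2)]] h.hom_inv[OF that(2)]
      using F.m_closed[OF that(1) F.inv_closed[OF that(2)]]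
      by (simp add: a_minus_def a_inv_def)
  qed
  have N: "biadditive_relations A M \<lhd> FG"
    by (intro biadditive_relations_normal A.abelian_group_axioms M.abelian_group_axioms)
  have ker: "c - d - e \<in> kernel FG (add_monoid M) (free_action M)"
    if cl: "c \<in> carrier FG" "d \<in> carrier FG" "e \<in> carrier FG"
      and eq: "free_action M c = free_action M d \<oplus>\<^bsub>M\<^esub> free_action M e" for c d e
  proof -
    have cd: "c - d \<in> carrier FG" using d[OF cl(1,2)] by blast
    have mem: "free_action M d \<in> carrier M" "free_action M e \<in> carrier M"
      using h.hom_closed[OF cl(2)] h.hom_closed[OF cl(3)] by auto
    have "free_action M (c - d - e)
        = (free_action M d \<oplus>\<^bsub>M\<^esub> free_action M e) \<ominus>\<^bsub>M\<^esub> (free_action M d \<oplus>\<^bsub>M\<^esub> free_action M e)"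
      using d[OF cl(1,2)] d[OF cd cl(3)] mem
      by (simp add: eq M.minus_eq M.minus_add M.a_assoc)
    then have "free_action M (c - d - e) = \<zero>\<^bsub>M\<^esub>"
      using mem by (simp add: M.minus_eq M.r_neg)
    moreover have "c - d - e \<in> carrier FG" using d[OF cd cl(3)] by blast
    ultimately show ?thesis by (simp add: kernel_def)
  qed
  have K: "biadditive_relations A M \<subseteq> kernel FG (add_monoid M) (free_action M)"
    unfolding biadditive_relations_def
  proof (rule F.generate_subgroup_incl[OF _ h.subgroup_kernel], safe)
    fix x x' y assume *: "x \<in> carrier A" "x' \<in> carrier A" "y \<in> carrier M"
    show "frag_of (x \<oplus> x', y) - frag_of (x, y) - frag_of (x', y)
        \<in> kernel FG (add_monoid M) (free_action M)"
      by (rule ker) (use * in \<open>simp_all only: f A.a_closed free_action_frag_of smult_l_distr\<close>)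
  next
    fix x y y' assume *: "x \<in> carrier A" "y \<in> carrier M" "y' \<in> carrier M"
    show "frag_of (x, y \<oplus>\<^bsub>M\<^esub> y') - frag_of (x, y) - frag_of (x, y')
        \<in> kernel FG (add_monoid M) (free_action M)"
      by (rule ker) (use * in \<open>simp_all only: f M.a_closed free_action_frag_of smult_r_distr\<close>)
  qed
  show "int_tensor_action M \<in> hom (int_tensor A M) (add_monoid M)"
    using h.induced_hom[OF N K]
    by (simp add: int_tensor_def int_tensor_action_def[abs_def])
  show "int_tensor_action M (int_pure_tensor A M a m) = a \<odot>\<^bsub>M\<^esub> m"
    if "a \<in> carrier A" "m \<in> carrier M"
    using h.induced_coset[OF N K f[OF that]] that
    by (simp add: int_tensor_action_def int_pure_tensor_def free_action_frag_of)
qed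

lemma comm_group_int_tensor: "comm_group (int_tensor A M)"
  unfolding int_tensor_def
  by (intro comm_group.abelian_FactGroup normal_imp_subgroup abelian_free_Abelian_group
      biadditive_relations_normal A.abelian_group_axioms M.abelian_group_axioms)

lemma int_pure_tensor_closed:
  "\<lbrakk>a \<in> carrier A; m \<in> carrier M\<rbrakk> \<Longrightarrow> int_pure_tensor A M a m \<in> carrier (int_tensor A M)"
  unfolding int_pure_tensor_def int_tensor_def carrier_FactGroup
  by (rule imageI) (simp add: free_Abelian_group_def)

lemma balanced_relations_normal: "balanced_relations A M \<lhd> int_tensor A M"
proof -
  interpret T: comm_group "int_tensor A M" by (rule comm_group_int_tensor)
  show ?thesis
    unfolding balanced_relations_def
    by (intro T.subgroup_imp_normal T.generate_is_subgroup)
      (auto intro!: T.m_closed T.inv_closed int_pure_tensor_closed smult_closed A.m_closed)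
qed

lemma tensor_action_hom: "tensor_action M \<in> hom (ring_tensor A M) (add_monoid M)"
  and tensor_action_pure_tensor: "\<lbrakk>a \<in> carrier A; m \<in> carrier M\<rbrakk>
    \<Longrightarrow> tensor_action M (pure_tensor A M a m) = a \<odot>\<^bsub>M\<^esub> m"
proof -
  interpret T: comm_group "int_tensor A M" by (rule comm_group_int_tensor)
  interpret h: group_hom "int_tensor A M" "add_monoid M" "int_tensor_action M"
    by (intro group_hom.intro group_hom_axioms.intro int_tensor_action_hom M.a_group T.is_group)
  note N = balanced_relations_normal
  have K: "balanced_relations A M
      \<subseteq> kernel (int_tensor A M) (add_monoid M) (int_tensor_action M)"
    unfolding balanced_relations_def
  proof (rule T.generate_subgroup_incl[OF _ h.subgroup_kernel], safe)
    fix a a' m assume *: "a \<in> carrier A" "a' \<in> carrier A" "m \<in> carrier M"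
    note c = int_pure_tensor_closed[OF A.m_closed[OF *(1,2)] *(3)]
      int_pure_tensor_closed[OF *(1) smult_closed[OF *(2,3)]]
    have "(a \<otimes> a') \<odot>\<^bsub>M\<^esub> m \<otimes>\<^bsub>add_monoid M\<^esub> inv\<^bsub>add_monoid M\<^esub> (a \<odot>\<^bsub>M\<^esub> (a' \<odot>\<^bsub>M\<^esub> m))
        = \<one>\<^bsub>add_monoid M\<^esub>"
      unfolding smult_assoc[OF *]
      by (rule group.r_inv[OF M.a_group]) (simp add: * smult_closed)
    then show "int_pure_tensor A M (a \<otimes> a') m \<otimes>\<^bsub>int_tensor A M\<^esub>
        inv\<^bsub>int_tensor A M\<^esub> int_pure_tensor A M a (a' \<odot>\<^bsub>M\<^esub> m)
        \<in> kernel (int_tensor A M) (add_monoid M) (int_tensor_action M)"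
      using h.hom_mult[OF c(1) T.inv_closed[OF c(2)]] h.hom_inv[OF c(2)] c *
      by (simp add: kernel_def int_tensor_action_pure smult_closed A.m_closed)
  qed
  show "tensor_action M \<in> hom (ring_tensor A M) (add_monoid M)"
    using h.induced_hom[OF N K] by (simp add: ring_tensor_def tensor_action_def[abs_def])
  show "tensor_action M (pure_tensor A M a m) = a \<odot>\<^bsub>M\<^esub> m"
    if "a \<in> carrier A" "m \<in> carrier M"
    using h.induced_coset[OF N K int_pure_tensor_closed[OF that]] that
    by (simp add: tensor_action_def pure_tensor_def int_tensor_action_pure)
qed

end

end

theory Submission
  imports Defs
begin

text \<open>The idea is that a left s-unital ring \<open>A\<close> has a left unit for any finite set of its
  elements (\<open>ex_common_left_unit\<close>). Let \<open>M\<close> be a left \<open>A\<close>-module. Only finitely many elements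
  of \<open>A\<close> occur in a finite sum \<open>m = \<Sum>\<^sub>i a\<^sub>i m\<^sub>i\<close>, so a common left unit \<open>e\<close> of the \<open>a\<^sub>i\<close>
  satisfies \<open>em = m\<close>; hence unitary modules are s-unital. The converse is immediate, as \<open>am\<close> is
  itself a sum with one term.

  The same \<open>e\<close> collapses a tensor to a pure one: \<open>\<Sum>\<^sub>i a\<^sub>i \<otimes> m\<^sub>i = \<Sum>\<^sub>i e a\<^sub>i \<otimes> m\<^sub>i = e \<otimes> \<Sum>\<^sub>i a\<^sub>i m\<^sub>i\<close>.
  So every \<open>x \<in> A \<otimes>\<^sub>A M\<close> has the form \<open>e \<otimes> \<mu>(x)\<close>, where \<open>\<mu>\<close> is the action map
  (\<open>tensor_eq_pure_tensor\<close>). In particular \<open>\<mu>\<close> is injective for every module \<open>M\<close>, so that being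
  firm amounts to surjectivity of \<open>\<mu>\<close>. If \<open>m = \<mu>(x)\<close>, then applying \<open>\<mu>\<close> to \<open>x = e \<otimes> m\<close> gives
  \<open>m = em\<close>; conversely \<open>m = am\<close> is \<open>\<mu>(a \<otimes> m)\<close>. Thus \<open>M\<close> is firm if and only if it is
  s-unital.\<close>

section \<open>Common left units\<close>

context left_module
begin

lemma smult_r_zero:
  assumes "a \<in> carrier A"
  shows "a \<odot>\<^bsub>M\<^esub> \<zero>\<^bsub>M\<^esub> = \<zero>\<^bsub>M\<^esub>"
proof -
  have "a \<odot>\<^bsub>M\<^esub> \<zero>\<^bsub>M\<^esub> \<oplus>\<^bsub>M\<^esub> a \<odot>\<^bsub>M\<^esub> \<zero>\<^bsub>M\<^esub> = a \<odot>\<^bsub>M\<^esub> \<zero>\<^bsub>M\<^esub>"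
    using smult_r_distr[OF assms M.zero_closed M.zero_closed] by simp
  then show ?thesis
    using smult_closed[OF assms M.zero_closed] M.add.l_cancel_one by metis
qed

lemma smult_l_minus_distr:
  assumes "a \<in> carrier A" "b \<in> carrier A" "m \<in> carrier M"
  shows "(a \<ominus> b) \<odot>\<^bsub>M\<^esub> m = a \<odot>\<^bsub>M\<^esub> m \<ominus>\<^bsub>M\<^esub> b \<odot>\<^bsub>M\<^esub> m"
proof -
  have c: "a \<ominus> b \<in> carrier A" using assms by simp
  have "(a \<ominus> b) \<oplus> b = a"
    using assms by (simp add: A.minus_eq A.a_assoc A.l_neg)
  then have *: "a \<odot>\<^bsub>M\<^esub> m = (a \<ominus> b) \<odot>\<^bsub>M\<^esub> m \<oplus>\<^bsub>M\<^esub> b \<odot>\<^bsub>M\<^esub> m"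
    using smult_l_distr[OF c assms(2,3)] by simp
  show ?thesis
    using smult_closed[OF c assms(3)] smult_closed[OF assms(2,3)]
    by (simp add: * M.minus_eq M.a_assoc M.r_neg)
qed

lemma smult_finsum:
  assumes "finite I" "e \<in> carrier A" "f \<in> I \<rightarrow> carrier M"
  shows "e \<odot>\<^bsub>M\<^esub> (\<Oplus>\<^bsub>M\<^esub>i\<in>I. f i) = (\<Oplus>\<^bsub>M\<^esub>i\<in>I. e \<odot>\<^bsub>M\<^esub> f i)"
  using assms
  by (induction I) (auto simp: smult_r_zero smult_r_distr smult_closed Pi_iff)

text \<open>The induction rests on \<open>1 - e = (1 - e\<^sub>2)(1 - e\<^sub>1)\<close>, written without \<open>1\<close> as
  \<open>e = e\<^sub>1 + e\<^sub>2 - e\<^sub>2 e\<^sub>1\<close>: if \<open>e\<^sub>1\<close> fixes the new element \<open>m\<close> and \<open>e\<^sub>2\<close> fixes \<open>n - e\<^sub>1 n\<close> for all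
  previous elements \<open>n\<close>, then \<open>e\<close> fixes \<open>m\<close> and all \<open>n\<close>. The induction hypothesis is applied to
  the set of all \<open>n - e\<^sub>1 n\<close>, so the induction is on the cardinality.\<close>

lemma ex_common_left_unit:
  assumes "s_unital A M" "finite F" "F \<subseteq> carrier M"
  shows "\<exists>e\<in>carrier A. \<forall>m\<in>F. e \<odot>\<^bsub>M\<^esub> m = m"
  using assms(2,3)
proof (induction "card F" arbitrary: F rule: less_induct)
  case less
  show ?case
  proof (cases "F = {}")
    case True
    then show ?thesis by auto
  next
    case False
    then obtain m where "m \<in> F" by blast
    then have m: "m \<in> carrier M" using less.prems by blast
    then obtain e\<^sub>1 where e1: "e\<^sub>1 \<in> carrier A" "e\<^sub>1 \<odot>\<^bsub>M\<^esub> m = m"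
      using assms(1) unfolding s_unital_def by force
    let ?G = "(\<lambda>n. n \<ominus>\<^bsub>M\<^esub> e\<^sub>1 \<odot>\<^bsub>M\<^esub> n) ` (F - {m})"
    have "card ?G \<le> card (F - {m})"
      using less.prems by (intro card_image_le) auto
    also have "\<dots> < card F"
      using \<open>m \<in> F\<close> less.prems by (intro psubset_card_mono) auto
    finally have "card ?G < card F" .
    moreover have "finite ?G" "?G \<subseteq> carrier M"
      using less.prems e1 by (auto simp: smult_closed)
    ultimately obtain e\<^sub>2 where e2: "e\<^sub>2 \<in> carrier A"
      "\<And>n. n \<in> F - {m} \<Longrightarrow> e\<^sub>2 \<odot>\<^bsub>M\<^esub> (n \<ominus>\<^bsub>M\<^esub> e\<^sub>1 \<odot>\<^bsub>M\<^esub> n) = n \<ominus>\<^bsub>M\<^esub> e\<^sub>1 \<odot>\<^bsub>M\<^esub> n"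
      using less.hyps[of ?G] by blast
    let ?e = "e\<^sub>1 \<oplus> (e\<^sub>2 \<ominus> e\<^sub>2 \<otimes> e\<^sub>1)"
    have e: "?e \<in> carrier A" using e1 e2(1) by (simp add: A.m_closed)
    have action: "?e \<odot>\<^bsub>M\<^esub> n = e\<^sub>1 \<odot>\<^bsub>M\<^esub> n \<oplus>\<^bsub>M\<^esub> e\<^sub>2 \<odot>\<^bsub>M\<^esub> (n \<ominus>\<^bsub>M\<^esub> e\<^sub>1 \<odot>\<^bsub>M\<^esub> n)"
      if n: "n \<in> carrier M" for n
    proof -
      have c: "e\<^sub>1 \<odot>\<^bsub>M\<^esub> n \<in> carrier M" "n \<ominus>\<^bsub>M\<^esub> e\<^sub>1 \<odot>\<^bsub>M\<^esub> n \<in> carrier M"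
        using e1 n by (auto simp: smult_closed)
      have "(n \<ominus>\<^bsub>M\<^esub> e\<^sub>1 \<odot>\<^bsub>M\<^esub> n) \<oplus>\<^bsub>M\<^esub> e\<^sub>1 \<odot>\<^bsub>M\<^esub> n = n"
        using c n by (simp add: M.minus_eq M.a_assoc M.l_neg)
      then have "e\<^sub>2 \<odot>\<^bsub>M\<^esub> n
          = e\<^sub>2 \<odot>\<^bsub>M\<^esub> (n \<ominus>\<^bsub>M\<^esub> e\<^sub>1 \<odot>\<^bsub>M\<^esub> n) \<oplus>\<^bsub>M\<^esub> e\<^sub>2 \<odot>\<^bsub>M\<^esub> (e\<^sub>1 \<odot>\<^bsub>M\<^esub> n)"
        using smult_r_distr[OF e2(1) c(2,1)] by simp
      then have "e\<^sub>2 \<odot>\<^bsub>M\<^esub> n \<ominus>\<^bsub>M\<^esub> e\<^sub>2 \<odot>\<^bsub>M\<^esub> (e\<^sub>1 \<odot>\<^bsub>M\<^esub> n) = e\<^sub>2 \<odot>\<^bsub>M\<^esub> (n \<ominus>\<^bsub>M\<^esub> e\<^sub>1 \<odot>\<^bsub>M\<^esub> n)"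
        using smult_closed[OF e2(1) c(1)] smult_closed[OF e2(1) c(2)]
        by (simp add: M.minus_eq M.a_assoc M.r_neg)
      then show ?thesis
        using e1(1) e2(1) n
        by (simp add: smult_l_distr smult_l_minus_distr smult_assoc A.m_closed)
    qed
    have "?e \<odot>\<^bsub>M\<^esub> m = m"
      using m e2(1) by (simp add: action e1(2) M.minus_eq M.r_neg smult_r_zero)
    moreover have "?e \<odot>\<^bsub>M\<^esub> n = n" if n: "n \<in> F - {m}" for n
    proof -
      have nc: "n \<in> carrier M" using n less.prems by blast
      have c: "e\<^sub>1 \<odot>\<^bsub>M\<^esub> n \<in> carrier M" using e1 nc by (simp add: smult_closed)
      have "?e \<odot>\<^bsub>M\<^esub> n = (n \<ominus>\<^bsub>M\<^esub> e\<^sub>1 \<odot>\<^bsub>M\<^esub> n) \<oplus>\<^bsub>M\<^esub> e\<^sub>1 \<odot>\<^bsub>M\<^esub> n"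
        using c nc by (simp add: action e2(2)[OF n] M.a_comm)
      then show ?thesis
        using c nc by (simp add: M.minus_eq M.a_assoc M.l_neg)
    qed
    ultimately show ?thesis using e by blast
  qed
qed

end

lemma left_s_unital_ring_ex_common_left_unit:
  assumes "left_s_unital_ring A" "finite F" "F \<subseteq> carrier A"
  shows "\<exists>e\<in>carrier A. \<forall>a\<in>F. e \<otimes>\<^bsub>A\<^esub> a = a"
proof -
  interpret R: left_module A "regular_module A"
    using assms(1) by (intro left_module_regular_module) (simp add: left_s_unital_ring_def)
  show ?thesis
    using R.ex_common_left_unit[of F] assms
    by (simp add: left_s_unital_ring_def regular_module_def)
qed

section \<open>Generation of the tensor product by pure tensors\<close>

context left_module
begin

lemma comm_group_ring_tensor: "comm_group (ring_tensor A M)"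
  unfolding ring_tensor_def
  by (intro comm_group.abelian_FactGroup normal_imp_subgroup comm_group_int_tensor
      balanced_relations_normal)

lemma int_tensor_projection_hom:
  "(\<lambda>c. biadditive_relations A M #>\<^bsub>FG\<^esub> c) \<in> hom FG (int_tensor A M)"
  unfolding int_tensor_def
  by (intro normal.r_coset_hom_Mod biadditive_relations_normal
      A.abelian_group_axioms M.abelian_group_axioms)

lemma ring_tensor_projection_hom:
  "(\<lambda>t. balanced_relations A M #>\<^bsub>int_tensor A M\<^esub> t) \<in> hom (int_tensor A M) (ring_tensor A M)"
  unfolding ring_tensor_def
  by (intro normal.r_coset_hom_Mod balanced_relations_normal)

lemma pure_tensor_closed:
  "\<lbrakk>a \<in> carrier A; m \<in> carrier M\<rbrakk> \<Longrightarrow> pure_tensor A M a m \<in> carrier (ring_tensor A M)"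
  unfolding pure_tensor_def
  by (intro hom_in_carrier[OF ring_tensor_projection_hom] int_pure_tensor_closed)

lemma int_pure_tensor_add_right:
  assumes "a \<in> carrier A" "m \<in> carrier M" "n \<in> carrier M"
  shows "int_pure_tensor A M a (m \<oplus>\<^bsub>M\<^esub> n)
    = int_pure_tensor A M a m \<otimes>\<^bsub>int_tensor A M\<^esub> int_pure_tensor A M a n"
proof -
  interpret F: comm_group FG by (rule abelian_free_Abelian_group)
  interpret N: normal "biadditive_relations A M" FG
    by (intro biadditive_relations_normal A.abelian_group_axioms M.abelian_group_axioms)
  let ?r = "frag_of (a, m \<oplus>\<^bsub>M\<^esub> n) - frag_of (a, m) - frag_of (a, n)"
  have r: "?r \<in> biadditive_relations A M"
    unfolding biadditive_relations_def using assms by (intro generate.incl) blast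
  have f: "frag_of (a, k) \<in> carrier FG" if "k \<in> carrier M" for k
    using assms that by (simp add: free_Abelian_group_def)
  have "frag_of (a, m \<oplus>\<^bsub>M\<^esub> n) = ?r \<otimes>\<^bsub>FG\<^esub> (frag_of (a, m) \<otimes>\<^bsub>FG\<^esub> frag_of (a, n))"
    by (simp add: free_Abelian_group_def)
  then have "frag_of (a, m \<oplus>\<^bsub>M\<^esub> n)
      \<in> biadditive_relations A M #>\<^bsub>FG\<^esub> (frag_of (a, m) \<otimes>\<^bsub>FG\<^esub> frag_of (a, n))"
    using r unfolding r_coset_def by blast
  then have "biadditive_relations A M #>\<^bsub>FG\<^esub> frag_of (a, m \<oplus>\<^bsub>M\<^esub> n)
      = biadditive_relations A M #>\<^bsub>FG\<^esub> (frag_of (a, m) \<otimes>\<^bsub>FG\<^esub> frag_of (a, n))"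
    using F.repr_independence[OF _ F.m_closed[OF f[OF assms(2)] f[OF assms(3)]]
        N.subgroup_axioms] by simp
  then show ?thesis
    using Group.hom_mult[OF int_tensor_projection_hom f[OF assms(2)] f[OF assms(3)]]
    by (simp add: int_pure_tensor_def)
qed

lemma pure_tensor_hom_right:
  assumes "a \<in> carrier A"
  shows "pure_tensor A M a \<in> hom (add_monoid M) (ring_tensor A M)"
proof (rule homI)
  fix m n assume "m \<in> carrier (add_monoid M)" "n \<in> carrier (add_monoid M)"
  then have mn: "m \<in> carrier M" "n \<in> carrier M" by simp_all
  show "pure_tensor A M a (m \<otimes>\<^bsub>add_monoid M\<^esub> n)
      = pure_tensor A M a m \<otimes>\<^bsub>ring_tensor A M\<^esub> pure_tensor A M a n"
    using assms mn Group.hom_mult[OF ring_tensor_projection_hom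
        int_pure_tensor_closed[OF assms mn(1)] int_pure_tensor_closed[OF assms mn(2)]]
    by (simp add: pure_tensor_def int_pure_tensor_add_right)
qed (use assms pure_tensor_closed in simp)

lemma pure_tensor_balanced:
  assumes "a \<in> carrier A" "b \<in> carrier A" "m \<in> carrier M"
  shows "pure_tensor A M (a \<otimes> b) m = pure_tensor A M a (b \<odot>\<^bsub>M\<^esub> m)"
proof -
  interpret T: comm_group "int_tensor A M" by (rule comm_group_int_tensor)
  interpret N: normal "balanced_relations A M" "int_tensor A M"
    by (rule balanced_relations_normal)
  let ?x = "int_pure_tensor A M (a \<otimes> b) m"
  let ?y = "int_pure_tensor A M a (b \<odot>\<^bsub>M\<^esub> m)"
  have c: "?x \<in> carrier (int_tensor A M)" "?y \<in> carrier (int_tensor A M)"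
    using assms by (auto intro!: int_pure_tensor_closed A.m_closed smult_closed)
  have r: "?x \<otimes>\<^bsub>int_tensor A M\<^esub> inv\<^bsub>int_tensor A M\<^esub> ?y \<in> balanced_relations A M"
    unfolding balanced_relations_def using assms by (intro generate.incl) blast
  have "?x = (?x \<otimes>\<^bsub>int_tensor A M\<^esub> inv\<^bsub>int_tensor A M\<^esub> ?y) \<otimes>\<^bsub>int_tensor A M\<^esub> ?y"
    using c by (simp add: T.m_assoc)
  then have "?x \<in> balanced_relations A M #>\<^bsub>int_tensor A M\<^esub> ?y"
    using r unfolding r_coset_def by blast
  then show ?thesis
    using T.repr_independence[OF _ c(2) N.subgroup_axioms] by (simp add: pure_tensor_def)
qed

lemma pure_tensors_generate:
  assumes H: "subgroup H (ring_tensor A M)"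
    and pure: "\<And>a m. \<lbrakk>a \<in> carrier A; m \<in> carrier M\<rbrakk> \<Longrightarrow> pure_tensor A M a m \<in> H"
  shows "H = carrier (ring_tensor A M)"
proof
  show "H \<subseteq> carrier (ring_tensor A M)" using H by (rule subgroup.subset)
  interpret F: comm_group FG by (rule abelian_free_Abelian_group)
  interpret T: comm_group "ring_tensor A M" by (rule comm_group_ring_tensor)
  define q where "q c = balanced_relations A M #>\<^bsub>int_tensor A M\<^esub>
      (biadditive_relations A M #>\<^bsub>FG\<^esub> c)" for c
  have "q \<in> hom FG (ring_tensor A M)"
    using hom_compose[OF int_tensor_projection_hom ring_tensor_projection_hom]
    by (simp add: q_def[abs_def] comp_def)
  then interpret q: group_hom FG "ring_tensor A M" q
    by (intro group_hom.intro group_hom_axioms.intro F.is_group T.is_group)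
  show "carrier (ring_tensor A M) \<subseteq> H"
  proof
    fix x assume "x \<in> carrier (ring_tensor A M)"
    then obtain c where c: "c \<in> carrier FG" "x = q c"
      by (auto simp: ring_tensor_def int_tensor_def carrier_FactGroup q_def)
    have "Poly_Mapping.keys c \<subseteq> carrier A \<times> carrier M"
      using c(1) by (simp add: free_Abelian_group_def)
    then have "c \<in> carrier FG \<and> q c \<in> H"
    proof (induction c rule: frag_induction)
      case zero
      show ?case
        using F.one_closed q.hom_one subgroup.one_closed[OF H]
        by (simp add: free_Abelian_group_def)
    next
      case (one p)
      then show ?case
        using pure[of "fst p" "snd p"]
        by (auto simp: free_Abelian_group_def q_def pure_tensor_def int_pure_tensor_def)
    next
      case (diff c d)
      then have cd: "c \<in> carrier FG" "d \<in> carrier FG" by auto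
      have eq: "c - d = c \<otimes>\<^bsub>FG\<^esub> inv\<^bsub>FG\<^esub> d"
        using cd by (simp add: free_Abelian_group_def inv_free_Abelian_group
            flip: free_Abelian_group_def)
      have "q (c - d) = q c \<otimes>\<^bsub>ring_tensor A M\<^esub> inv\<^bsub>ring_tensor A M\<^esub> q d"
        unfolding eq q.hom_mult[OF cd(1) F.inv_closed[OF cd(2)]] q.hom_inv[OF cd(2)] ..
      moreover have "c - d \<in> carrier FG"
        unfolding eq by (rule F.m_closed[OF cd(1) F.inv_closed[OF cd(2)]])
      ultimately show ?case
        using diff by (simp only: subgroup.m_closed[OF H] subgroup.m_inv_closed[OF H])
    qed
    then show "x \<in> H" using c(2) by simp
  qed
qed

section \<open>Injectivity of the action map\<close>

text \<open>The set of tensors \<open>x\<close> admitting a finite set \<open>F\<close> of coefficients such that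
  \<open>x = e \<otimes> \<mu>(x)\<close> for \<^emph>\<open>all\<close> common left units \<open>e\<close> of \<open>F\<close> is a subgroup: quantifying over all
  such \<open>e\<close> makes it possible to add two tensors by uniting their sets of coefficients. It contains
  the pure tensors, for \<open>a \<otimes> m = ea \<otimes> m = e \<otimes> am\<close> as soon as \<open>ea = a\<close>.\<close>

lemma tensor_eq_pure_tensor:
  assumes "left_s_unital_ring A" "x \<in> carrier (ring_tensor A M)"
  obtains e where "e \<in> carrier A" "x = pure_tensor A M e (tensor_action M x)"
proof -
  let ?T = "ring_tensor A M"
  interpret T: comm_group ?T by (rule comm_group_ring_tensor)
  interpret \<mu>: group_hom ?T "add_monoid M" "tensor_action M"
    by (intro group_hom.intro group_hom_axioms.intro tensor_action_hom M.a_group T.is_group)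
  have pure: "group_hom (add_monoid M) ?T (pure_tensor A M e)" if "e \<in> carrier A" for e
    by (intro group_hom.intro group_hom_axioms.intro pure_tensor_hom_right M.a_group T.is_group that)
  define collapses where "collapses F y \<longleftrightarrow> finite F \<and> F \<subseteq> carrier A \<and>
    (\<forall>e\<in>carrier A. (\<forall>a\<in>F. e \<otimes> a = a) \<longrightarrow> y = pure_tensor A M e (tensor_action M y))" for F y
  let ?H = "{y \<in> carrier ?T. \<exists>F. collapses F y}"
  have "?H = carrier ?T"
  proof (rule pure_tensors_generate)
    show "subgroup ?H ?T"
    proof (rule T.subgroupI)
      have "collapses {} \<one>\<^bsub>?T\<^esub>"
        unfolding collapses_def using group_hom.hom_one[OF pure] \<mu>.hom_one by simp
      then show "?H \<noteq> {}" by blast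
    next
      fix y assume "y \<in> ?H"
      then obtain F where y: "y \<in> carrier ?T" and F: "collapses F y" by blast
      have "collapses F (inv\<^bsub>?T\<^esub> y)"
        unfolding collapses_def
      proof (intro conjI ballI impI)
        fix e assume e: "e \<in> carrier A" "\<forall>a\<in>F. e \<otimes> a = a"
        have "pure_tensor A M e (tensor_action M (inv\<^bsub>?T\<^esub> y))
            = inv\<^bsub>?T\<^esub> (pure_tensor A M e (tensor_action M y))"
          using group_hom.hom_inv[OF pure[OF e(1)] \<mu>.hom_closed[OF y]] \<mu>.hom_inv[OF y] by simp
        then show "inv\<^bsub>?T\<^esub> y = pure_tensor A M e (tensor_action M (inv\<^bsub>?T\<^esub> y))"
          using F e unfolding collapses_def by metis
      qed (use F in \<open>auto simp: collapses_def\<close>)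
      then show "inv\<^bsub>?T\<^esub> y \<in> ?H" using y by blast
    next
      fix y z assume "y \<in> ?H" "z \<in> ?H"
      then obtain F G where y: "y \<in> carrier ?T" and F: "collapses F y"
        and z: "z \<in> carrier ?T" and G: "collapses G z" by blast
      have "collapses (F \<union> G) (y \<otimes>\<^bsub>?T\<^esub> z)"
        unfolding collapses_def
      proof (intro conjI ballI impI)
        fix e assume e: "e \<in> carrier A" "\<forall>a\<in>F \<union> G. e \<otimes> a = a"
        have "pure_tensor A M e (tensor_action M (y \<otimes>\<^bsub>?T\<^esub> z))
            = pure_tensor A M e (tensor_action M y) \<otimes>\<^bsub>?T\<^esub> pure_tensor A M e (tensor_action M z)"
          using group_hom.hom_mult[OF pure[OF e(1)] \<mu>.hom_closed[OF y] \<mu>.hom_closed[OF z]]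
            \<mu>.hom_mult[OF y z] by simp
        then show "y \<otimes>\<^bsub>?T\<^esub> z = pure_tensor A M e (tensor_action M (y \<otimes>\<^bsub>?T\<^esub> z))"
          using F G e unfolding collapses_def by (metis UnI1 UnI2)
      qed (use F G in \<open>auto simp: collapses_def\<close>)
      then show "y \<otimes>\<^bsub>?T\<^esub> z \<in> ?H" using y z by blast
    qed auto
  next
    fix a m assume am: "a \<in> carrier A" "m \<in> carrier M"
    have "collapses {a} (pure_tensor A M a m)"
      unfolding collapses_def tensor_action_pure_tensor[OF am]
    proof (intro conjI ballI impI)
      fix e assume e: "e \<in> carrier A" "\<forall>b\<in>{a}. e \<otimes> b = b"
      then show "pure_tensor A M a m = pure_tensor A M e (a \<odot>\<^bsub>M\<^esub> m)"
        using pure_tensor_balanced[OF e(1) am] by simp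
    qed (simp_all add: am)
    then show "pure_tensor A M a m \<in> ?H" using am pure_tensor_closed by blast
  qed
  then obtain F where F: "collapses F x" using assms(2) by blast
  then have "finite F" "F \<subseteq> carrier A" by (simp_all add: collapses_def)
  from left_s_unital_ring_ex_common_left_unit[OF assms(1) this]
  obtain e where e: "e \<in> carrier A" "\<forall>a\<in>F. e \<otimes> a = a" by blast
  then have "x = pure_tensor A M e (tensor_action M x)" using F by (simp add: collapses_def)
  with e(1) show thesis by (rule that)
qed

lemma inj_on_tensor_action:
  assumes "left_s_unital_ring A"
  shows "inj_on (tensor_action M) (carrier (ring_tensor A M))"
proof -
  interpret T: comm_group "ring_tensor A M" by (rule comm_group_ring_tensor)
  interpret \<mu>: group_hom "ring_tensor A M" "add_monoid M" "tensor_action M"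
    by (intro group_hom.intro group_hom_axioms.intro tensor_action_hom M.a_group T.is_group)
  have "x = \<one>\<^bsub>ring_tensor A M\<^esub>"
    if x: "x \<in> carrier (ring_tensor A M)" "tensor_action M x = \<one>\<^bsub>add_monoid M\<^esub>" for x
  proof -
    obtain e where e: "e \<in> carrier A" "x = pure_tensor A M e (tensor_action M x)"
      using tensor_eq_pure_tensor[OF assms x(1)] .
    interpret pure: group_hom "add_monoid M" "ring_tensor A M" "pure_tensor A M e"
      by (intro group_hom.intro group_hom_axioms.intro pure_tensor_hom_right M.a_group
          T.is_group e(1))
    show ?thesis using e(2) pure.hom_one unfolding x(2) by simp
  qed
  then show ?thesis by (auto simp: \<mu>.inj_on_one_iff)
qed

section \<open>Unitary, firm and s-unital modules\<close>

lemma firm_iff_s_unital: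
  assumes "left_s_unital_ring A"
  shows "firm A M \<longleftrightarrow> s_unital A M"
proof
  assume firm: "firm A M"
  show "s_unital A M"
    unfolding s_unital_def
  proof
    fix m assume m: "m \<in> carrier M"
    have "tensor_action M ` carrier (ring_tensor A M) = carrier M"
      using firm by (simp add: firm_def iso_def bij_betw_def)
    then have "m \<in> tensor_action M ` carrier (ring_tensor A M)" using m by simp
    then obtain x where x: "x \<in> carrier (ring_tensor A M)" "tensor_action M x = m" by auto
    obtain e where e: "e \<in> carrier A" "x = pure_tensor A M e (tensor_action M x)"
      using tensor_eq_pure_tensor[OF assms x(1)] .
    have "m = e \<odot>\<^bsub>M\<^esub> m"
      using tensor_action_pure_tensor[OF e(1) m] e(2) x(2) by simp
    then show "m \<in> {a \<odot>\<^bsub>M\<^esub> m | a. a \<in> carrier A}" using e(1) by blast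
  qed
next
  assume s: "s_unital A M"
  have "tensor_action M ` carrier (ring_tensor A M) = carrier M"
  proof
    show "tensor_action M ` carrier (ring_tensor A M) \<subseteq> carrier M"
      using hom_in_carrier[OF tensor_action_hom] by auto
    show "carrier M \<subseteq> tensor_action M ` carrier (ring_tensor A M)"
    proof
      fix m assume m: "m \<in> carrier M"
      then obtain a where "a \<in> carrier A" "m = a \<odot>\<^bsub>M\<^esub> m"
        using s unfolding s_unital_def by blast
      then show "m \<in> tensor_action M ` carrier (ring_tensor A M)"
        using m tensor_action_pure_tensor pure_tensor_closed by (metis imageI)
    qed
  qed
  then show "firm A M"
    using tensor_action_hom inj_on_tensor_action[OF assms]
    by (simp add: firm_def iso_def bij_betw_def)
qed

lemma unitary_iff_s_unital:
  assumes "left_s_unital_ring A"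
  shows "unitary A M \<longleftrightarrow> s_unital A M"
proof
  assume unitary: "unitary A M"
  show "s_unital A M"
    unfolding s_unital_def
  proof
    fix m assume "m \<in> carrier M"
    then have "m \<in> smult_span A M" using unitary by (simp add: unitary_def)
    then obtain n :: nat and a k where m: "m = (\<Oplus>\<^bsub>M\<^esub>i\<in>{..<n}. a i \<odot>\<^bsub>M\<^esub> k i)"
      and ak: "a \<in> {..<n} \<rightarrow> carrier A" "k \<in> {..<n} \<rightarrow> carrier M"
      unfolding smult_span_def by blast
    have "a ` {..<n} \<subseteq> carrier A" using ak(1) by blast
    then obtain e where e: "e \<in> carrier A" "\<forall>b\<in>a ` {..<n}. e \<otimes> b = b"
      using left_s_unital_ring_ex_common_left_unit[OF assms, of "a ` {..<n}"] by auto
    have "e \<odot>\<^bsub>M\<^esub> m = (\<Oplus>\<^bsub>M\<^esub>i\<in>{..<n}. e \<odot>\<^bsub>M\<^esub> (a i \<odot>\<^bsub>M\<^esub> k i))"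
      unfolding m using e(1) ak by (intro smult_finsum) (auto simp: Pi_iff smult_closed)
    also have "\<dots> = m"
      unfolding m using e ak
      by (intro M.finsum_cong') (auto simp: Pi_iff smult_closed simp flip: smult_assoc)
    finally show "m \<in> {a \<odot>\<^bsub>M\<^esub> m | a. a \<in> carrier A}" using e(1) by force
  qed
next
  assume s: "s_unital A M"
  show "unitary A M"
    unfolding unitary_def
  proof
    show "smult_span A M \<subseteq> carrier M"
      by (auto simp: smult_span_def Pi_iff intro!: M.finsum_closed smult_closed)
    show "carrier M \<subseteq> smult_span A M"
    proof
      fix m assume m: "m \<in> carrier M"
      then obtain a where a: "a \<in> carrier A" "m = a \<odot>\<^bsub>M\<^esub> m"
        using s unfolding s_unital_def by blast
      have "m = (\<Oplus>\<^bsub>M\<^esub>i\<in>{..<1::nat}. a \<odot>\<^bsub>M\<^esub> m)"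
        using a m by (simp add: lessThan_Suc smult_closed)
      then show "m \<in> smult_span A M"
        unfolding smult_span_def using a(1) m
        by (intro CollectI exI[of _ "1::nat"] exI[of _ "\<lambda>_. a"] exI[of _ "\<lambda>_. m"]) auto
    qed
  qed
qed

end

theorem proposition31:
  fixes A :: "('a, 'p) ring_scheme"
  assumes "left_s_unital_ring A"
  shows "(UMod A :: ('a, 'b, 'q) module_scheme set) = FMod A
    \<and> (FMod A :: ('a, 'b, 'q) module_scheme set) = SMod A"
  by (auto simp: UMod_def FMod_def SMod_def left_module.firm_iff_s_unital[OF _ assms]
      left_module.unitary_iff_s_unital[OF _ assms])

end
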